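(* If $n$ is a non-negative integer and $r$ and $s$ are integers, then \[ 10\sum_{k = 0}^{\lfloor n/2 \rfloor } \binom n{2k}F_{k + r} F_{k + s} = L_{2n + r + s} + ( - 1)^{r + s} L_{n - r - s}- ( - 1)^s 2^{n/2+1} \cos\Big(\frac{n\pi}{4}\Big)L_{r - s}, \] \[ 2\sum_{k = 0}^{\lfloor n/2 \rfloor } \binom n{2k}L_{k + r} F_{k + s} = F_{2n + r + s} - ( - 1)^{r + s} F_{n - r - s}- ( - 1)^s 2^{n/2+1} \cos\Big(\frac{n\pi}{4}\Big)F_{r - s}, \] \[ 2\sum_{k = 0}^{\lfloor n/2 \rfloor } \binom n{2k}L_{k + r} L_{k + s} = L_{2n + r + s} + ( - 1)^{r + s} L_{n - r - s} + ( - 1)^s 2^{n/2+1} \cos\Big(\frac{n\pi}{4}\Big)L_{r - s}. \]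
   Context: The Fibonacci numbers $F_j$ and Lucas numbers $L_j$ are defined for all integers $j$ by $F_0=0$, $F_1=1$, $L_0=2$, $L_1=1$, $F_j=F_{j-1}+F_{j-2}$, $L_j=L_{j-1}+L_{j-2}$, with $F_{-j}=(-1)^{j-1}F_j$ and $L_{-j}=(-1)^jL_j$. *)

theory Defs
  imports Complex_Main "HOL-Number_Theory.Fib"
begin

fun lucas_nat :: "nat \<Rightarrow> nat" where
  "lucas_nat 0 = 2"
| "lucas_nat (Suc 0) = 1"
| "lucas_nat (Suc (Suc n)) = lucas_nat (Suc n) + lucas_nat n"

definition fibonacci :: "int \<Rightarrow> int" where
  "fibonacci j =
     (if 0 \<le> j then int (fib (nat j))
      else (-1) ^ (nat (- j) - 1) * int (fib (nat (- j))))"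

definition lucas :: "int \<Rightarrow> int" where
  "lucas j =
     (if 0 \<le> j then int (lucas_nat (nat j))
      else (-1) ^ nat (- j) * int (lucas_nat (nat (- j))))"

lemma fibonacci_initial: "fibonacci 0 = 0" "fibonacci 1 = 1"
  by (simp_all add: fibonacci_def)

lemma lucas_initial: "lucas 0 = 2" "lucas 1 = 1"
  by (simp_all add: lucas_def)

lemma int_index_cases:
  fixes j :: int
  obtains (nonneg) m where "j = int m + 2" | (one) "j = 1" | (zero) "j = 0"
    | (neg) m where "j = - int (Suc m)"
proof -
  consider "j \<ge> 2" | "j = 1" | "j = 0" | "j < 0" by linarith
  then show thesis
  proof cases
    case 1
    then have "j = int (nat (j - 2)) + 2" by simp
    then show thesis by (rule nonneg)
  next
    case 4
    then have "j = - int (Suc (nat (- j - 1)))" by simp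
    then show thesis by (rule neg)
  qed (auto intro: one zero)
qed

lemma fibonacci_rec: "fibonacci j = fibonacci (j - 1) + fibonacci (j - 2)"
proof (cases j rule: int_index_cases)
  case (nonneg m)
  then have "nat j = Suc (Suc m)" "nat (j - 1) = Suc m" "nat (j - 2) = m" by auto
  with nonneg show ?thesis by (simp add: fibonacci_def)
next
  case (neg m)
  then have "nat (- j) = Suc m" "nat (- (j - 1)) = Suc (Suc m)"
    "nat (- (j - 2)) = Suc (Suc (Suc m))" by auto
  with neg show ?thesis by (simp add: fibonacci_def algebra_simps)
qed (simp_all add: fibonacci_def numeral_2_eq_2)

lemma lucas_rec: "lucas j = lucas (j - 1) + lucas (j - 2)"
proof (cases j rule: int_index_cases)
  case (nonneg m)
  then have "nat j = Suc (Suc m)" "nat (j - 1) = Suc m" "nat (j - 2) = m" by auto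
  with nonneg show ?thesis by (simp add: lucas_def)
next
  case (neg m)
  then have "nat (- j) = Suc m" "nat (- (j - 1)) = Suc (Suc m)"
    "nat (- (j - 2)) = Suc (Suc (Suc m))" by auto
  with neg show ?thesis by (simp add: lucas_def algebra_simps)
qed (simp_all add: lucas_def numeral_2_eq_2)

lemma fibonacci_minus: "fibonacci (- j) = (-1) powi (j - 1) * fibonacci j"
  by (cases j "0 :: int" rule: linorder_cases)
    (auto simp: fibonacci_def power_int_def nat_diff_distrib minus_one_power_iff even_nat_iff)

lemma lucas_minus: "lucas (- j) = (-1) powi j * lucas j"
  by (cases j "0 :: int" rule: linorder_cases)
    (auto simp: lucas_def power_int_def minus_one_power_iff even_nat_iff)

end

theory Submission
  imports Defs
begin

text \<open>
  By Binet's formulas each product of two Fibonacci or Lucas numbers splits into the powers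
  \<open>\<phi>\<^bsup>2k+r+s\<^esup>\<close>, \<open>\<psi>\<^bsup>2k+r+s\<^esup>\<close> and a multiple of \<open>(-1)\<^bsup>k\<^esup>\<close>. The sums are
  therefore values of \<open>2 \<Sum> (n choose 2k) x\<^bsup>2k\<^esup> = (1 + x)\<^bsup>n\<^esup> + (1 - x)\<^bsup>n\<^esup>\<close> at
  \<open>x = \<phi>, \<psi>, \<i>\<close>, where \<open>1 + \<phi> = \<phi>\<^sup>2\<close>, \<open>1 - \<phi> = \<psi>\<close> (and symmetrically), and
  \<open>1 + \<i> = \<surd>2 cis (\<pi>/4)\<close>.
\<close>

definition golden :: real ("\<phi>") where "\<phi> = (1 + sqrt 5) / 2"

definition golden_conj :: real ("\<psi>") where "\<psi> = (1 - sqrt 5) / 2"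

lemma golden_square: "\<phi>\<^sup>2 = 1 + \<phi>" "\<psi>\<^sup>2 = 1 + \<psi>"
  by (simp_all add: golden_def golden_conj_def power2_eq_square field_simps)

lemma golden_add: "\<phi> + \<psi> = 1"
  by (simp add: golden_def golden_conj_def field_simps)

lemma golden_mult: "\<phi> * \<psi> = -1"
  by (simp add: golden_def golden_conj_def field_simps)

lemma golden_diff: "\<phi> - \<psi> = sqrt 5"
  by (simp add: golden_def golden_conj_def field_simps)

lemma golden_nonzero: "\<phi> \<noteq> 0" "\<psi> \<noteq> 0"
  using golden_mult by auto

text \<open>The recurrence can also be solved for its oldest term, so two neighbouring values
  determine the sequence in both directions. The induction from 0 therefore carries the pair at
  \<open>j\<close> and \<open>j + 1\<close>; subtraction in the group serves the downward
  step.\<close>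

lemma fibonacci_recurrence_unique:
  fixes f g :: "int \<Rightarrow> 'a :: ab_group_add"
  assumes f: "\<And>j. f j = f (j - 1) + f (j - 2)" and g: "\<And>j. g j = g (j - 1) + g (j - 2)"
    and "f 0 = g 0" "f 1 = g 1"
  shows "f j = g j"
proof -
  have "f j = g j \<and> f (j + 1) = g (j + 1)"
  proof (induction j rule: int_induct[where k = 0])
    case base
    then show ?case using assms(3,4) by simp
  next
    case (step1 i)
    then show ?case using f[of "i + 2"] g[of "i + 2"] by (simp add: algebra_simps)
  next
    case (step2 i)
    then show ?case using f[of "i + 1"] g[of "i + 1"] by (simp add: algebra_simps)
  qed
  then show ?thesis ..
qed

lemma power_int_fibonacci_recurrence:
  fixes x :: "'a :: field"
  assumes "x\<^sup>2 = 1 + x" "x \<noteq> 0"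
  shows "x powi j = x powi (j - 1) + x powi (j - 2)"
proof -
  have "x powi j = x powi (j - 2) * x\<^sup>2" "x powi (j - 1) = x powi (j - 2) * x"
    using power_int_add[of x "j - 2" 2] power_int_add[of x "j - 2" 1] assms(2) by simp_all
  then show ?thesis using assms(1) by (simp add: algebra_simps)
qed

text \<open>Both sides obey the Fibonacci recurrence and agree at 0 and 1. Keeping
  \<open>sqrt 5\<close> on the left avoids divisions when products are expanded later.\<close>

lemma fibonacci_binet: "sqrt 5 * of_int (fibonacci j) = \<phi> powi j - \<psi> powi j"
proof (rule fibonacci_recurrence_unique[where j = j])
  show "sqrt 5 * of_int (fibonacci j) =
      sqrt 5 * of_int (fibonacci (j - 1)) + sqrt 5 * of_int (fibonacci (j - 2))" for j
    by (subst fibonacci_rec) (simp add: algebra_simps)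
  show "\<phi> powi j - \<psi> powi j =
      \<phi> powi (j - 1) - \<psi> powi (j - 1) + (\<phi> powi (j - 2) - \<psi> powi (j - 2))" for j
    using power_int_fibonacci_recurrence[OF golden_square(1) golden_nonzero(1), of j]
      power_int_fibonacci_recurrence[OF golden_square(2) golden_nonzero(2), of j] by simp
qed (simp_all add: fibonacci_initial golden_diff)

lemma lucas_binet: "of_int (lucas j) = \<phi> powi j + \<psi> powi j"
proof (rule fibonacci_recurrence_unique[where j = j])
  show "real_of_int (lucas j) = of_int (lucas (j - 1)) + of_int (lucas (j - 2))" for j
    by (subst lucas_rec) simp
  show "\<phi> powi j + \<psi> powi j =
      \<phi> powi (j - 1) + \<psi> powi (j - 1) + (\<phi> powi (j - 2) + \<psi> powi (j - 2))" for j
    using power_int_fibonacci_recurrence[OF golden_square(1) golden_nonzero(1), of j]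
      power_int_fibonacci_recurrence[OF golden_square(2) golden_nonzero(2), of j] by simp
qed (simp_all add: lucas_initial golden_add)

text \<open>Adding the binomial expansions at \<open>x\<close> and \<open>- x\<close> cancels the
  odd powers and doubles the even ones. The ring is left general because both real arguments and the
  complex argument \<open>\<i>\<close> are needed.\<close>

lemma sum_even_binomial_power:
  fixes x :: "'a :: comm_ring_1"
  shows "2 * (\<Sum>k = 0..n div 2. of_nat (n choose (2 * k)) * x ^ (2 * k)) = (1 + x) ^ n + (1 - x) ^ n"
proof -
  let ?t = "\<lambda>k. of_nat (n choose k) * x ^ k"
  have "(1 + x) ^ n + (1 - x) ^ n = (\<Sum>k\<le>n. ?t k) + (\<Sum>k\<le>n. of_nat (n choose k) * (- x) ^ k)"
    using binomial_ring[of x 1 n] binomial_ring[of "- x" 1 n] by (simp add: add.commute)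
  also have "\<dots> = (\<Sum>k\<le>n. if even k then 2 * ?t k else 0)"
    unfolding sum.distrib[symmetric] by (intro sum.cong) (auto simp: algebra_simps)
  also have "\<dots> = (\<Sum>k | k \<le> n \<and> even k. 2 * ?t k)"
    by (simp add: sum.If_cases Collect_conj_eq atMost_def)
  also have "\<dots> = (\<Sum>k = 0..n div 2. 2 * ?t (2 * k))"
    by (rule sum.reindex_bij_witness[of _ "\<lambda>k. 2 * k" "\<lambda>k. k div 2"]) auto
  finally show ?thesis by (simp add: sum_distrib_left)
qed

lemma sum_even_binomial_alternating:
  "2 * (\<Sum>k = 0..n div 2. real (n choose (2 * k)) * (-1) ^ k) =
    2 powr (real n / 2 + 1) * cos (real n * pi / 4)"
proof -
  let ?S = "\<Sum>k = 0..n div 2. real (n choose (2 * k)) * (-1) ^ k"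
  have "2 * complex_of_real ?S =
      2 * (\<Sum>k = 0..n div 2. of_nat (n choose (2 * k)) * \<i> ^ (2 * k))"
    by (simp add: power_mult)
  also have "\<dots> = (1 + \<i>) ^ n + (1 - \<i>) ^ n"
    by (rule sum_even_binomial_power)
  also have "1 + \<i> = of_real (sqrt 2) * cis (pi / 4)"
    by (simp add: complex_eq_iff cos_45 sin_45)
  also have "1 - \<i> = of_real (sqrt 2) * cis (- (pi / 4))"
    by (simp add: complex_eq_iff cos_45 sin_45)
  \<comment> \<open>The two powers are complex conjugates, so the real part of their sum is twice
    that of one of them, which De Moivre's formula evaluates.\<close>
  finally have "Re (2 * complex_of_real ?S) =
      Re ((of_real (sqrt 2) * cis (pi / 4)) ^ n + (of_real (sqrt 2) * cis (- (pi / 4))) ^ n)"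
    by (rule arg_cong)
  then have "2 * ?S = 2 * (sqrt 2 ^ n * cos (real n * pi / 4))"
    by (simp add: power_mult_distrib Complex.DeMoivre flip: of_real_power)
  moreover have "sqrt 2 ^ n = 2 powr (real n / 2)"
    by (simp add: powr_half_sqrt[symmetric] powr_power)
  ultimately show ?thesis by (simp add: powr_add)
qed

text \<open>Here \<open>1 + x\<close> becomes \<open>x\<^sup>2\<close> and \<open>1 - x\<close>
  becomes \<open>y\<close>, so the even binomial sum is \<open>x ^ (2 * n) + y ^ n\<close>, to be
  shifted by \<open>x powi m\<close>. Stating it for abstract \<open>x\<close> and \<open>y\<close>
  covers both \<open>\<phi>, \<psi>\<close> and \<open>\<psi>, \<phi>\<close>.\<close>

lemma sum_even_binomial_power_int:
  fixes x y :: real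
  assumes "x\<^sup>2 = 1 + x" "x + y = 1" "x * y = -1"
  shows "2 * (\<Sum>k = 0..n div 2. real (n choose (2 * k)) * x powi (2 * int k + m)) =
    x powi (2 * int n + m) + (-1) powi m * y powi (int n - m)"
proof -
  have nz: "x \<noteq> 0" "y \<noteq> 0" using assms(3) by auto
  have split: "x powi (2 * int k + m) = x ^ (2 * k) * x powi m" for k
    using nz power_int_of_nat[of x "2 * k"] by (simp add: power_int_add)
  have "2 * (\<Sum>k = 0..n div 2. real (n choose (2 * k)) * x powi (2 * int k + m)) =
      2 * (\<Sum>k = 0..n div 2. real (n choose (2 * k)) * x ^ (2 * k)) * x powi m"
    unfolding split by (simp add: sum_distrib_left sum_distrib_right mult_ac)
  also have "\<dots> = ((1 + x) ^ n + (1 - x) ^ n) * x powi m"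
    by (simp only: sum_even_binomial_power)
  also have "1 + x = x\<^sup>2" using assms(1) by simp
  also have "1 - x = y" using assms(2) by simp
  finally have *: "2 * (\<Sum>k = 0..n div 2. real (n choose (2 * k)) * x powi (2 * int k + m)) =
      x powi (2 * int n + m) + y ^ n * x powi m"
    unfolding split power_mult by (simp add: distrib_right)
  \<comment> \<open>Reading -1 as \<open>x * y\<close> absorbs the sign and turns the second term
    into \<open>y ^ n * x powi m\<close>.\<close>
  have "(-1) powi m * y powi (int n - m) = x powi m * (y powi m * y powi (int n - m))"
    unfolding assms(3)[symmetric] by (simp add: power_int_mult_distrib)
  also have "\<dots> = x powi m * y ^ n"
    using nz by (simp flip: power_int_add)
  finally show ?thesis using * by simp
qed

text \<open>Pulling out \<open>(x * y) powi (int k + s)\<close> leaves only a sign and the surplus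
  \<open>x powi (r - s)\<close>. This is the source of the index \<open>r - s\<close> and of the
  sign depending on \<open>s\<close> alone.\<close>

lemma power_int_mult_shift:
  fixes x y :: real
  assumes "x * y = -1"
  shows "x powi (int k + r) * y powi (int k + s) = (-1) ^ k * ((-1) powi s * x powi (r - s))"
proof -
  have nz: "x \<noteq> 0" "y \<noteq> 0" using assms by auto
  have "x powi (int k + r) = x powi (int k + s) * x powi (r - s)"
    using nz by (simp flip: power_int_add)
  then have "x powi (int k + r) * y powi (int k + s) = (x * y) powi (int k + s) * x powi (r - s)"
    by (simp add: power_int_mult_distrib)
  then show ?thesis by (simp add: assms power_int_add)
qed

lemma power_int_mult_same:
  fixes x :: real
  assumes "x \<noteq> 0"
  shows "x powi (int k + r) * x powi (int k + s) = x powi (2 * int k + (r + s))"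
  using assms by (simp add: algebra_simps flip: power_int_add)

lemma golden_power_int_mult:
  "\<phi> powi (int k + r) * \<phi> powi (int k + s) = \<phi> powi (2 * int k + (r + s))"
  "\<psi> powi (int k + r) * \<psi> powi (int k + s) = \<psi> powi (2 * int k + (r + s))"
  "\<phi> powi (int k + r) * \<psi> powi (int k + s) = (-1) ^ k * ((-1) powi s * \<phi> powi (r - s))"
  "\<psi> powi (int k + r) * \<phi> powi (int k + s) = (-1) ^ k * ((-1) powi s * \<psi> powi (r - s))"
  using golden_mult golden_nonzero
  by (auto intro!: power_int_mult_same power_int_mult_shift simp: mult.commute[of \<psi> \<phi>])

text \<open>Common shape of the three products: \<open>a\<close> and \<open>b\<close> are the signs
  of the pure powers, and \<open>c\<close> collects the mixed terms, which depend on
  \<open>k\<close> only through \<open>(-1) ^ k\<close>. By linearity, each piece is a sum already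
  evaluated.\<close>

lemma sum_even_binomial_golden_combination:
  fixes a b c :: real
  assumes "\<And>k. g k = a * \<phi> powi (2 * int k + m) + b * \<psi> powi (2 * int k + m) + (-1) ^ k * c"
  shows "2 * (\<Sum>k = 0..n div 2. real (n choose (2 * k)) * g k) =
    a * (\<phi> powi (2 * int n + m) + (-1) powi m * \<psi> powi (int n - m)) +
    b * (\<psi> powi (2 * int n + m) + (-1) powi m * \<phi> powi (int n - m)) +
    2 powr (real n / 2 + 1) * cos (real n * pi / 4) * c"
proof -
  have "2 * (\<Sum>k = 0..n div 2. real (n choose (2 * k)) * g k) =
      a * (2 * (\<Sum>k = 0..n div 2. real (n choose (2 * k)) * \<phi> powi (2 * int k + m))) +
      b * (2 * (\<Sum>k = 0..n div 2. real (n choose (2 * k)) * \<psi> powi (2 * int k + m))) +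
      2 * (\<Sum>k = 0..n div 2. real (n choose (2 * k)) * (-1) ^ k) * c"
    by (simp add: assms sum_distrib_left sum_distrib_right sum.distrib algebra_simps)
  moreover have "\<psi> + \<phi> = 1" "\<psi> * \<phi> = -1"
    using golden_add golden_mult by (simp_all add: ac_simps)
  ultimately show ?thesis
    using golden_add golden_mult golden_square
    by (simp only: sum_even_binomial_power_int sum_even_binomial_alternating)
qed

theorem theorem25:
  fixes n :: nat and r s :: int
  shows
    "10 * (\<Sum>k = 0..n div 2. real (n choose (2 * k)) *
          of_int (fibonacci (int k + r)) * of_int (fibonacci (int k + s))) =
       of_int (lucas (2 * int n + r + s)) + (-1) powi (r + s) * of_int (lucas (int n - r - s))
       - (-1) powi s * 2 powr (real n / 2 + 1) * cos (real n * pi / 4) * of_int (lucas (r - s)) \<and>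
     2 * (\<Sum>k = 0..n div 2. real (n choose (2 * k)) *
          of_int (lucas (int k + r)) * of_int (fibonacci (int k + s))) =
       of_int (fibonacci (2 * int n + r + s)) - (-1) powi (r + s) * of_int (fibonacci (int n - r - s))
       - (-1) powi s * 2 powr (real n / 2 + 1) * cos (real n * pi / 4) * of_int (fibonacci (r - s)) \<and>
     2 * (\<Sum>k = 0..n div 2. real (n choose (2 * k)) *
          of_int (lucas (int k + r)) * of_int (lucas (int k + s))) =
       of_int (lucas (2 * int n + r + s)) + (-1) powi (r + s) * of_int (lucas (int n - r - s))
       + (-1) powi s * 2 powr (real n / 2 + 1) * cos (real n * pi / 4) * of_int (lucas (r - s))"
proof (intro conjI)
  let ?E = "2 powr (real n / 2 + 1) * cos (real n * pi / 4)"
  let ?B = "\<lambda>k. real (n choose (2 * k))"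
  \<comment> \<open>Each Fibonacci factor absorbs one \<open>sqrt 5\<close>; this 5 and the doubling
    of the sum make the 10 of the claim. The mixed terms enter negatively and add up to a Lucas
    number.\<close>
  have ff: "5 * (real_of_int (fibonacci (int k + r)) * of_int (fibonacci (int k + s))) =
      1 * \<phi> powi (2 * int k + (r + s)) + 1 * \<psi> powi (2 * int k + (r + s)) +
      (-1) ^ k * - ((-1) powi s * of_int (lucas (r - s)))" for k
  proof -
    have "5 * (real_of_int (fibonacci (int k + r)) * of_int (fibonacci (int k + s))) =
        (sqrt 5 * of_int (fibonacci (int k + r))) * (sqrt 5 * of_int (fibonacci (int k + s)))"
      by simp
    then show ?thesis
      unfolding fibonacci_binet lucas_binet
      by (simp add: left_diff_distrib right_diff_distrib golden_power_int_mult)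
        (simp add: algebra_simps)
  qed
  \<comment> \<open>With \<open>a = 1\<close> and \<open>b = -1\<close>, the terms at index
    \<open>n - r - s\<close> appear as \<open>\<psi>\<close> minus \<open>\<phi>\<close>, the
    reverse of Binet's order; hence the minus sign before that Fibonacci number.\<close>
  have lf: "sqrt 5 * (real_of_int (lucas (int k + r)) * of_int (fibonacci (int k + s))) =
      1 * \<phi> powi (2 * int k + (r + s)) + (-1) * \<psi> powi (2 * int k + (r + s)) +
      (-1) ^ k * - ((-1) powi s * (sqrt 5 * of_int (fibonacci (r - s))))" for k
  proof -
    have "sqrt 5 * (real_of_int (lucas (int k + r)) * of_int (fibonacci (int k + s))) =
        of_int (lucas (int k + r)) * (sqrt 5 * of_int (fibonacci (int k + s)))"
      by simp
    then show ?thesis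
      unfolding fibonacci_binet lucas_binet
      by (simp add: distrib_right right_diff_distrib golden_power_int_mult)
  qed
  have ll: "real_of_int (lucas (int k + r)) * of_int (lucas (int k + s)) =
      1 * \<phi> powi (2 * int k + (r + s)) + 1 * \<psi> powi (2 * int k + (r + s)) +
      (-1) ^ k * ((-1) powi s * of_int (lucas (r - s)))" for k
    unfolding lucas_binet
    by (simp add: distrib_right distrib_left golden_power_int_mult)
  show "10 * (\<Sum>k = 0..n div 2. ?B k *
          of_int (fibonacci (int k + r)) * of_int (fibonacci (int k + s))) =
       of_int (lucas (2 * int n + r + s)) + (-1) powi (r + s) * of_int (lucas (int n - r - s))
       - (-1) powi s * 2 powr (real n / 2 + 1) * cos (real n * pi / 4) * of_int (lucas (r - s))"
    using sum_even_binomial_golden_combination[OF ff, of n]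
      lucas_binet[of "2 * int n + r + s"] lucas_binet[of "int n - r - s"]
    by (simp add: sum_distrib_left algebra_simps)
  \<comment> \<open>Every Fibonacci number here carries the one factor \<open>sqrt 5\<close>
    required by Binet's formula, so it can be cancelled from the whole identity at the end.\<close>
  have "sqrt 5 * (2 * (\<Sum>k = 0..n div 2. ?B k *
          of_int (lucas (int k + r)) * of_int (fibonacci (int k + s)))) =
       sqrt 5 * of_int (fibonacci (2 * int n + r + s))
       - (-1) powi (r + s) * (sqrt 5 * of_int (fibonacci (int n - r - s)))
       - (-1) powi s * ?E * (sqrt 5 * of_int (fibonacci (r - s)))"
    using sum_even_binomial_golden_combination[OF lf, of n]
    unfolding fibonacci_binet[of "2 * int n + r + s"] fibonacci_binet[of "int n - r - s"]
    by (simp add: sum_distrib_left algebra_simps)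
  also have "\<dots> = sqrt 5 * (of_int (fibonacci (2 * int n + r + s))
       - (-1) powi (r + s) * of_int (fibonacci (int n - r - s))
       - (-1) powi s * 2 powr (real n / 2 + 1) * cos (real n * pi / 4) *
         of_int (fibonacci (r - s)))"
    by (simp add: algebra_simps)
  finally show "2 * (\<Sum>k = 0..n div 2. ?B k *
          of_int (lucas (int k + r)) * of_int (fibonacci (int k + s))) =
       of_int (fibonacci (2 * int n + r + s)) - (-1) powi (r + s) * of_int (fibonacci (int n - r - s))
       - (-1) powi s * 2 powr (real n / 2 + 1) * cos (real n * pi / 4) * of_int (fibonacci (r - s))"
    by (subst (asm) mult_left_cancel) simp_all
  show "2 * (\<Sum>k = 0..n div 2. ?B k *
          of_int (lucas (int k + r)) * of_int (lucas (int k + s))) =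
       of_int (lucas (2 * int n + r + s)) + (-1) powi (r + s) * of_int (lucas (int n - r - s))
       + (-1) powi s * 2 powr (real n / 2 + 1) * cos (real n * pi / 4) * of_int (lucas (r - s))"
    using sum_even_binomial_golden_combination[OF ll, of n]
      lucas_binet[of "2 * int n + r + s"] lucas_binet[of "int n - r - s"]
    by (simp add: sum_distrib_left algebra_simps)
qed

end
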